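(* Let $0\le\epsilon,\delta\le 1$, let $D_{\mathcal X^n}$ be a probability distribution on $\mathcal X^n$, let $q\in\mathcal Q$ be a query, and let $M:\mathcal X^n\times\mathcal Q\to\mathcal R$ be a (possibly randomized) mechanism that is $(\epsilon,\delta)$-LSS with respect to $D_{\mathcal X^n}$ and $q$. Then for any (countable) set $\mathcal U$ and any (possibly randomized) function $f:\mathcal R\to\mathcal U$, the mechanism $f\circ M:\mathcal X^n\times\mathcal Q\to\mathcal U$ is also $(\epsilon,\delta)$-LSS with respect to $D_{\mathcal X^n}$ and $q$. The analogous statement also holds for mechanisms that are LSS with respect to a family of queries and/or a family of distributions: if $M$ is $(\epsilon,\delta)$-LSS with respect to every distribution in a family and every query in a family, then so is $f\circ M$.
   Context: $\mathcal X$ (domain), $\mathcal Q$ (queries), $\mathcal R$ (responses) and $\mathcal U$ are countable sets and $n\in\mathbb N$. A mechanism $M:\mathcal X^n\times\mathcal Q\to\mathcal R$ is a possibly randomized function; for fixed $q$, write $D(r\mid s)=\Pr[M(s,q)=r]$ (probability over the internal randomness of $M$). A randomized $f$ uses randomness independent of everything else given its input. Induced distributions. Write $D(s)=D_{\mathcal X^n}(s)$, $D(r)=\sum_{s}D(s)D(r\mid s)$, $D(s\mid r)=D(s)D(r\mid s)/D(r)$. For $s=(s_1,\dots,s_n)$ let $D(x\mid s)=\frac1n|\{i:s_i=x\}|$ be the probability of getting $x$ by sampling a uniformly random element of $s$; let $D(x)=\sum_s D(s)D(x\mid s)$ and $D(x\mid r)=\sum_s D(s\mid r)D(x\mid s)$.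 Only responses $r$ with $D(r)>0$ matter. For a set $\mathbf r$ of responses, $D(\mathbf r)=\sum_{r\in\mathbf r}D(r)$. Stability loss: $\ell(r)=\sum_{x:\,D(x\mid r)>D(x)}\big(D(x\mid r)-D(x)\big)$, and for a set $\mathbf r\subseteq\mathcal R$, $\ell(\mathbf r)=\frac{1}{D(\mathbf r)}\sum_{r\in\mathbf r}D(r)\ell(r)$. $M$ is $(\epsilon,\delta)$-Local-Statistically Stable (LSS) with respect to $D_{\mathcal X^n}$ and $q$ if for every $\mathbf r\subseteq\mathcal R$, $D(\mathbf r)\cdot(\ell(\mathbf r)-\epsilon)\le\delta$, i.e. $\sum_{r\in\mathbf r}D(r)(\ell(r)-\epsilon)\le\delta$. The same definitions apply to $f\circ M$ with response set $\mathcal U$. *)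

theory Defs
  imports "HOL-Probability.Probability"
begin

text \<open>
  Samples in \<open>X^n\<close> are vectors \<open>'x ^ 'n\<close>, with \<open>n = CARD('n) \<ge> 1\<close>.  A mechanism maps a sample and
  a query to the distribution of its response, so that \<open>D(r | s)\<close> is \<open>pmf (M (s, q)) r\<close>.
  All infinite sums below have nonnegative terms and converge.  Responses of probability zero
  contribute nothing: division by zero yields zero, so their stability loss is zero.
\<close>

type_synonym ('x, 'n, 'q, 'r) mechanism = "('x ^ 'n) \<times> 'q \<Rightarrow> 'r pmf"

definition response_prob ::
  "('x ^ 'n) pmf \<Rightarrow> ('x, 'n, 'q, 'r) mechanism \<Rightarrow> 'q \<Rightarrow> 'r \<Rightarrow> real" where
  "response_prob D M q r = (\<Sum>\<^sub>\<infinity>s. pmf D s * pmf (M (s, q)) r)"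

definition response_set_prob ::
  "('x ^ 'n) pmf \<Rightarrow> ('x, 'n, 'q, 'r) mechanism \<Rightarrow> 'q \<Rightarrow> 'r set \<Rightarrow> real" where
  "response_set_prob D M q rs = (\<Sum>\<^sub>\<infinity>r\<in>rs. response_prob D M q r)"

definition posterior_sample_prob ::
  "('x ^ 'n) pmf \<Rightarrow> ('x, 'n, 'q, 'r) mechanism \<Rightarrow> 'q \<Rightarrow> 'r \<Rightarrow> 'x ^ 'n \<Rightarrow> real" where
  "posterior_sample_prob D M q r s = pmf D s * pmf (M (s, q)) r / response_prob D M q r"

definition empirical_prob :: "'x ^ 'n \<Rightarrow> 'x \<Rightarrow> real" where
  "empirical_prob s x = real (card {i. s $ i = x}) / real CARD('n)"

definition element_prob :: "('x ^ 'n) pmf \<Rightarrow> 'x \<Rightarrow> real" where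
  "element_prob D x = (\<Sum>\<^sub>\<infinity>s. pmf D s * empirical_prob s x)"

definition posterior_element_prob ::
  "('x ^ 'n) pmf \<Rightarrow> ('x, 'n, 'q, 'r) mechanism \<Rightarrow> 'q \<Rightarrow> 'r \<Rightarrow> 'x \<Rightarrow> real" where
  "posterior_element_prob D M q r x =
     (\<Sum>\<^sub>\<infinity>s. posterior_sample_prob D M q r s * empirical_prob s x)"

definition stability_loss ::
  "('x ^ 'n) pmf \<Rightarrow> ('x, 'n, 'q, 'r) mechanism \<Rightarrow> 'q \<Rightarrow> 'r \<Rightarrow> real" where
  "stability_loss D M q r =
     (\<Sum>\<^sub>\<infinity>x\<in>{x. posterior_element_prob D M q r x > element_prob D x}.
        posterior_element_prob D M q r x - element_prob D x)"

definition set_stability_loss ::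
  "('x ^ 'n) pmf \<Rightarrow> ('x, 'n, 'q, 'r) mechanism \<Rightarrow> 'q \<Rightarrow> 'r set \<Rightarrow> real" where
  "set_stability_loss D M q rs =
     1 / response_set_prob D M q rs *
       (\<Sum>\<^sub>\<infinity>r\<in>rs. response_prob D M q r * stability_loss D M q r)"

definition LSS ::
  "real \<Rightarrow> real \<Rightarrow> ('x ^ 'n) pmf \<Rightarrow> 'q \<Rightarrow> ('x, 'n, 'q, 'r) mechanism \<Rightarrow> bool" where
  "LSS \<epsilon> \<delta> D q M \<longleftrightarrow>
     (\<forall>rs. response_set_prob D M q rs * (set_stability_loss D M q rs - \<epsilon>) \<le> \<delta>)"

text \<open>
  The composition of a randomized function \<open>f\<close> with a mechanism: \<open>f\<close> draws fresh randomness,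
  independent of everything else given its input, which is monadic composition of distributions.
\<close>

definition post_process ::
  "('r \<Rightarrow> 'u pmf) \<Rightarrow> ('x, 'n, 'q, 'r) mechanism \<Rightarrow> ('x, 'n, 'q, 'u) mechanism" where
  "post_process f M = (\<lambda>sq. bind_pmf (M sq) f)"

end

theory Submission
  imports Defs
begin

text \<open>
  Scaled by the response probability, the stability loss of a response \<open>r\<close> is the total positive
  part over \<open>x\<close> of \<open>D(r, x) - D(r) D(x)\<close>, with no division left.  Post-processing mixes these
  differences over \<open>r\<close> with the weights \<open>f(u | r)\<close>, so by convexity of the positive part the scaled
  loss of \<open>u\<close> is at most the same mixture of the scaled losses.  LSS bounds the sum of
  \<open>D(r) (\<ell>(r) - \<epsilon>)\<close> over any set of responses, in particular over those where this term is
  positive; since the weights \<open>f(u | r)\<close> sum to at most one over any set of \<open>u\<close>, the bound carries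
  over to the post-processed mechanism.
\<close>

section \<open>Infinite sums and discrete distributions\<close>

lemma has_sum_diff:
  fixes f g :: "'a \<Rightarrow> 'b::topological_ab_group_add"
  assumes "(f has_sum a) A" "(g has_sum b) A"
  shows "((\<lambda>x. f x - g x) has_sum (a - b)) A"
  using has_sum_add[OF assms(1), of "\<lambda>x. - g x" "- b"] assms(2) by (simp add: has_sum_uminus)

lemma summable_on_diff:
  fixes f g :: "'a \<Rightarrow> 'b::topological_ab_group_add"
  shows "f summable_on A \<Longrightarrow> g summable_on A \<Longrightarrow> (\<lambda>x. f x - g x) summable_on A"
  unfolding summable_on_def by (blast intro: has_sum_diff)

lemma infsum_diff:
  fixes f g :: "'a \<Rightarrow> 'b::{topological_ab_group_add, t2_space}"
  assumes "f summable_on A" "g summable_on A"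
  shows "(\<Sum>\<^sub>\<infinity>x\<in>A. f x - g x) = infsum f A - infsum g A"
  using assms by (intro infsumI has_sum_diff has_sum_infsum)

lemma pmf_summable_on: "pmf p summable_on A"
proof -
  have "(\<lambda>x. norm (pmf p x)) summable_on A"
    by (rule abs_summable_equivalent[THEN iffD2]) (rule pmf_abs_summable)
  then show ?thesis by simp
qed

lemma infsum_pmf_le_1: "(\<Sum>\<^sub>\<infinity>x\<in>A. pmf p x) \<le> 1"
proof -
  have "(\<Sum>\<^sub>\<infinity>x\<in>A. pmf p x) = infsetsum (pmf p) A"
    by (rule infsetsum_infsum[symmetric]) (rule pmf_abs_summable)
  also have "\<dots> \<le> 1"
    by (simp flip: measure_pmf_conv_infsetsum)
  finally show ?thesis .
qed

lemma pmf_mult_summable_on: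
  fixes g :: "'a \<Rightarrow> real"
  assumes "\<And>x. 0 \<le> g x" "\<And>x. g x \<le> 1"
  shows "(\<lambda>x. pmf p x * g x) summable_on A"
  by (rule summable_on_comparison_test[OF pmf_summable_on[of p]]) (auto simp: assms mult_left_le)

text \<open>The law of total probability in \<open>infsum\<close> form; it identifies the sums in
  the definitions as masses of a \<open>bind_pmf\<close>.\<close>

lemma pmf_bind_infsum: "pmf (bind_pmf p k) y = (\<Sum>\<^sub>\<infinity>x. pmf p x * pmf (k x) y)"
proof -
  have "(\<lambda>x. norm (pmf p x * pmf (k x) y)) summable_on UNIV"
    by (simp add: pmf_mult_summable_on pmf_le_1)
  then show ?thesis
    unfolding abs_summable_equivalent
    by (simp add: pmf_bind pmf_expectation_eq_infsetsum infsetsum_infsum)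
qed

text \<open>For fixed \<open>x\<close> the kernel has total mass at most one, so the inner sums are
  dominated by \<open>w\<close>. Joint summability is what later licenses interchanging
  sums.\<close>

lemma kernel_summable_on:
  fixes w :: "'a \<Rightarrow> real"
  assumes "w summable_on A" "\<And>x. x \<in> A \<Longrightarrow> 0 \<le> w x"
  shows "(\<lambda>(x, y). w x * pmf (k x) y) summable_on A \<times> B"
proof (rule summable_on_SigmaI, unfold prod.case)
  show "((\<lambda>y. w x * pmf (k x) y) has_sum w x * (\<Sum>\<^sub>\<infinity>y\<in>B. pmf (k x) y)) B" for x
    by (intro has_sum_cmult_right has_sum_infsum pmf_summable_on)
  show "(\<lambda>x. w x * (\<Sum>\<^sub>\<infinity>y\<in>B. pmf (k x) y)) summable_on A"
    by (rule summable_on_comparison_test[OF assms(1)])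
      (auto simp: assms(2) mult_left_le infsum_pmf_le_1 infsum_nonneg)
qed (auto simp: assms)

section \<open>Joint law of response and element, and the loss without division\<close>

definition element_pmf :: "'x ^ 'n \<Rightarrow> 'x pmf" where
  "element_pmf s = map_pmf (($) s) (pmf_of_set UNIV)"

definition response_pmf ::
  "('x ^ 'n) pmf \<Rightarrow> ('x, 'n, 'q, 'r) mechanism \<Rightarrow> 'q \<Rightarrow> 'r pmf" where
  "response_pmf D M q = bind_pmf D (\<lambda>s. M (s, q))"

text \<open>Response and element are drawn independently given the sample. This is
  \<open>D(r, x)\<close>; having it as a pmf gives summability over pairs at once.\<close>

definition joint_pmf ::
  "('x ^ 'n) pmf \<Rightarrow> ('x, 'n, 'q, 'r) mechanism \<Rightarrow> 'q \<Rightarrow> ('r \<times> 'x) pmf" where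
  "joint_pmf D M q = bind_pmf D (\<lambda>s. pair_pmf (M (s, q)) (element_pmf s))"

text \<open>The positive part replaces a sum over a set of \<open>x\<close> that varies with
  \<open>r\<close>, so that all sums range over a fixed type.\<close>

definition excess ::
  "('x ^ 'n) pmf \<Rightarrow> ('x, 'n, 'q, 'r) mechanism \<Rightarrow> 'q \<Rightarrow> 'r \<Rightarrow> 'x \<Rightarrow> real" where
  "excess D M q r x = max 0 (pmf (joint_pmf D M q) (r, x) - response_prob D M q r * element_prob D x)"

definition scaled_loss ::
  "('x ^ 'n) pmf \<Rightarrow> ('x, 'n, 'q, 'r) mechanism \<Rightarrow> 'q \<Rightarrow> 'r \<Rightarrow> real" where
  "scaled_loss D M q r = (\<Sum>\<^sub>\<infinity>x. excess D M q r x)"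

lemma pmf_element_pmf:
  fixes s :: "'x ^ 'n::finite"
  shows "pmf (element_pmf s) x = empirical_prob s x"
  by (simp add: element_pmf_def empirical_prob_def pmf_map measure_pmf_of_set vimage_def)

lemma element_prob_nonneg: "0 \<le> element_prob D x"
  by (auto simp: element_prob_def empirical_prob_def intro!: infsum_nonneg)

lemma response_prob_eq_pmf: "response_prob D M q r = pmf (response_pmf D M q) r"
  by (simp add: response_prob_def response_pmf_def pmf_bind_infsum)

lemma response_prob_nonneg: "0 \<le> response_prob D M q r"
  by (simp add: response_prob_eq_pmf)

lemma response_prob_summable_on: "response_prob D M q summable_on A"
  by (simp add: response_prob_eq_pmf[abs_def] pmf_summable_on)

lemma pmf_joint_pmf:
  fixes M :: "('x, 'n::finite, 'q, 'r) mechanism"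
  shows "pmf (joint_pmf D M q) (r, x) = (\<Sum>\<^sub>\<infinity>s. pmf D s * pmf (M (s, q)) r * empirical_prob s x)"
  by (simp add: joint_pmf_def pmf_bind_infsum pmf_pair pmf_element_pmf mult.assoc)

text \<open>If \<open>r\<close> is never produced, no pair \<open>(r, x)\<close> lies in the joint
  support. This settles the case where the posterior divides by zero.\<close>

lemma pmf_joint_pmf_eq_0:
  assumes "response_prob D M q r = 0"
  shows "pmf (joint_pmf D M q) (r, x) = 0"
  using assms by (auto simp: response_prob_eq_pmf response_pmf_def joint_pmf_def pmf_eq_0_set_pmf)

lemma posterior_element_prob_eq:
  fixes M :: "('x, 'n::finite, 'q, 'r) mechanism"
  shows "posterior_element_prob D M q r x = pmf (joint_pmf D M q) (r, x) / response_prob D M q r"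
proof -
  have "posterior_element_prob D M q r x =
      (\<Sum>\<^sub>\<infinity>s. (pmf D s * pmf (M (s, q)) r * empirical_prob s x) * (1 / response_prob D M q r))"
    by (simp add: posterior_element_prob_def posterior_sample_prob_def)
  then show ?thesis
    by (simp only: infsum_cmult_left' pmf_joint_pmf) simp
qed

text \<open>A nonnegative factor moves inside the positive part and clears the denominator of the
  posterior. If the factor is zero, the joint mass vanishes too, and both sides are zero.\<close>

lemma scaled_loss_eq:
  fixes M :: "('x, 'n::finite, 'q, 'r) mechanism"
  shows "response_prob D M q r * stability_loss D M q r = scaled_loss D M q r"
proof -
  have "stability_loss D M q r =
      (\<Sum>\<^sub>\<infinity>x. max 0 (posterior_element_prob D M q r x - element_prob D x))"
    unfolding stability_loss_def by (rule infsum_cong_neutral) auto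
  then have "response_prob D M q r * stability_loss D M q r =
      (\<Sum>\<^sub>\<infinity>x. response_prob D M q r * max 0 (posterior_element_prob D M q r x - element_prob D x))"
    by (simp add: infsum_cmult_right')
  also have "\<dots> = scaled_loss D M q r"
    unfolding scaled_loss_def
  proof (rule infsum_cong)
    fix x
    show "response_prob D M q r * max 0 (posterior_element_prob D M q r x - element_prob D x) =
        excess D M q r x"
      using pmf_joint_pmf_eq_0[of D M q r x] response_prob_nonneg[of D M q r]
      by (cases "response_prob D M q r = 0")
        (auto simp: excess_def posterior_element_prob_eq max_mult_distrib_left right_diff_distrib)
  qed
  finally show ?thesis .
qed

lemma excess_nonneg: "0 \<le> excess D M q r x"
  by (simp add: excess_def)

text \<open>The subtracted product is nonnegative, so the joint mass dominates the excess.\<close>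

lemma excess_summable_on: "(\<lambda>(r, x). excess D M q r x) summable_on A \<times> B"
  by (rule summable_on_comparison_test[OF pmf_summable_on[of "joint_pmf D M q"]])
    (auto simp: excess_def response_prob_nonneg element_prob_nonneg)

lemma scaled_loss_nonneg: "0 \<le> scaled_loss D M q r"
  by (simp add: scaled_loss_def excess_nonneg infsum_nonneg)

lemma scaled_loss_summable_on: "scaled_loss D M q summable_on A"
  using summable_on_Sigma_banach[OF excess_summable_on[of D M q A UNIV]]
  by (simp add: scaled_loss_def[abs_def])

text \<open>Multiplying by \<open>D(rs)\<close> cancels the normalisation, leaving a sum of one
  signed term per response.\<close>

lemma LSS_iff:
  fixes M :: "('x, 'n::finite, 'q, 'r) mechanism"
  shows "LSS \<epsilon> \<delta> D q M \<longleftrightarrow>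
    (\<forall>rs. (\<Sum>\<^sub>\<infinity>r\<in>rs. scaled_loss D M q r - \<epsilon> * response_prob D M q r) \<le> \<delta>)"
proof -
  have "response_set_prob D M q rs * (set_stability_loss D M q rs - \<epsilon>) =
      (\<Sum>\<^sub>\<infinity>r\<in>rs. scaled_loss D M q r - \<epsilon> * response_prob D M q r)" for rs
  proof -
    let ?S = "\<Sum>\<^sub>\<infinity>r\<in>rs. scaled_loss D M q r"
    \<comment> \<open>The cancellation fails when \<open>D(rs)\<close> is zero. The left side is
      then zero, so \<open>?S\<close> has to vanish as well.\<close>
    have "?S = 0" if "response_set_prob D M q rs = 0"
    proof (rule infsum_0)
      fix r assume "r \<in> rs"
      then have "response_prob D M q r = 0"
        using that response_prob_nonneg
        by (intro nonneg_infsum_le_0D[OF _ response_prob_summable_on])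
          (auto simp: response_set_prob_def)
      then show "scaled_loss D M q r = 0"
        by (simp flip: scaled_loss_eq)
    qed
    then have "response_set_prob D M q rs * (set_stability_loss D M q rs - \<epsilon>) =
        ?S - \<epsilon> * response_set_prob D M q rs"
      by (auto simp: set_stability_loss_def scaled_loss_eq right_diff_distrib)
    also have "\<dots> = (\<Sum>\<^sub>\<infinity>r\<in>rs. scaled_loss D M q r - \<epsilon> * response_prob D M q r)"
      by (simp add: response_set_prob_def infsum_diff infsum_cmult_right' scaled_loss_summable_on
          response_prob_summable_on summable_on_cmult_right)
    finally show ?thesis .
  qed
  then show ?thesis by (simp add: LSS_def)
qed

section \<open>Post-processing as mixing over responses\<close>

lemma response_prob_post_process:
  "response_prob D (post_process f M) q u = (\<Sum>\<^sub>\<infinity>r. response_prob D M q r * pmf (f r) u)"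
proof -
  have "response_pmf D (post_process f M) q = bind_pmf (response_pmf D M q) f"
    by (simp add: response_pmf_def post_process_def bind_assoc_pmf)
  then show ?thesis by (simp add: response_prob_eq_pmf pmf_bind_infsum)
qed

text \<open>The randomness of \<open>f\<close> is independent of the element given the response, so
  only the response coordinate is mixed.\<close>

lemma pmf_joint_pmf_post_process:
  fixes M :: "('x, 'n::finite, 'q, 'r) mechanism"
  shows "pmf (joint_pmf D (post_process f M) q) (u, x) =
    (\<Sum>\<^sub>\<infinity>r. pmf (joint_pmf D M q) (r, x) * pmf (f r) u)"
proof -
  let ?g = "\<lambda>s r. pmf D s * pmf (M (s, q)) r * empirical_prob s x * pmf (f r) u"
  have e: "0 \<le> empirical_prob s x" "empirical_prob s x \<le> 1" for s :: "'x ^ 'n"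
    by (simp_all add: pmf_le_1 flip: pmf_element_pmf)
  \<comment> \<open>The majorant is \<open>D(s) D(r | s)\<close>; the two remaining factors are at
    most one.\<close>
  have sm: "(\<lambda>(s, r). ?g s r) summable_on UNIV \<times> UNIV"
    by (rule summable_on_comparison_test[OF kernel_summable_on[where k = "\<lambda>s. M (s, q)", OF pmf_summable_on]])
      (auto simp: e pmf_le_1 mult.assoc intro!: mult_left_mono mult_left_le mult_le_one)
  have "pmf (joint_pmf D (post_process f M) q) (u, x) = (\<Sum>\<^sub>\<infinity>s. \<Sum>\<^sub>\<infinity>r. ?g s r)"
    by (simp add: pmf_joint_pmf post_process_def pmf_bind_infsum mult_ac
        flip: infsum_cmult_right' infsum_cmult_left')
  also have "\<dots> = (\<Sum>\<^sub>\<infinity>r. \<Sum>\<^sub>\<infinity>s. ?g s r)"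
    by (rule infsum_swap_banach[OF sm])
  also have "\<dots> = (\<Sum>\<^sub>\<infinity>r. pmf (joint_pmf D M q) (r, x) * pmf (f r) u)"
    by (simp add: pmf_joint_pmf infsum_cmult_left')
  finally show ?thesis .
qed

text \<open>The signed differences mix exactly; only taking the positive part, for each
  \<open>x\<close>, costs an inequality. Summing over \<open>x\<close> and interchanging sums
  finishes the argument.\<close>

lemma scaled_loss_post_process_le:
  fixes M :: "('x, 'n::finite, 'q, 'r) mechanism"
  shows "scaled_loss D (post_process f M) q u \<le> (\<Sum>\<^sub>\<infinity>r. scaled_loss D M q r * pmf (f r) u)"
proof -
  let ?h = "\<lambda>r x. excess D M q r x * pmf (f r) u"
  have sm: "(\<lambda>(r, x). ?h r x) summable_on UNIV \<times> UNIV"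
    by (rule summable_on_comparison_test[OF excess_summable_on[of D M q]])
      (auto simp: excess_nonneg pmf_le_1 mult_left_le)
  then have sm': "(\<lambda>(x, r). ?h r x) summable_on UNIV \<times> UNIV"
    by (subst summable_on_swap) simp
  have le: "excess D (post_process f M) q u x \<le> (\<Sum>\<^sub>\<infinity>r. ?h r x)" for x
  proof -
    have sJ: "(\<lambda>r. pmf (joint_pmf D M q) (r, x) * pmf (f r) u) summable_on UNIV"
    proof (rule summable_on_comparison_test[OF response_prob_summable_on[of D M q]])
      fix r
      \<comment> \<open>A single pair has at most the mass of its first marginal.\<close>
      have "pmf (joint_pmf D M q) (r, x) \<le> response_prob D M q r"
      proof -
        have "response_pmf D M q = map_pmf fst (joint_pmf D M q)"
          by (simp add: response_pmf_def joint_pmf_def map_bind_pmf map_fst_pair_pmf)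
        then show ?thesis
          by (auto simp: response_prob_eq_pmf pmf_map measure_pmf_single[symmetric]
              simp del: measure_pmf_single intro!: measure_pmf.finite_measure_mono)
      qed
      then show "pmf (joint_pmf D M q) (r, x) * pmf (f r) u \<le> response_prob D M q r"
        using mult_left_le[OF pmf_le_1 pmf_nonneg] by (meson order_trans)
    qed auto
    have sR: "(\<lambda>r. response_prob D M q r * pmf (f r) u * element_prob D x) summable_on UNIV"
      by (intro summable_on_cmult_left) (simp add: response_prob_eq_pmf pmf_mult_summable_on pmf_le_1)
    have "pmf (joint_pmf D (post_process f M) q) (u, x)
          - response_prob D (post_process f M) q u * element_prob D x
        = (\<Sum>\<^sub>\<infinity>r. pmf (joint_pmf D M q) (r, x) * pmf (f r) u
            - response_prob D M q r * pmf (f r) u * element_prob D x)"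
      by (simp add: pmf_joint_pmf_post_process response_prob_post_process infsum_diff[OF sJ sR]
          infsum_cmult_left')
    also have "\<dots> \<le> (\<Sum>\<^sub>\<infinity>r. ?h r x)"
    proof (rule infsum_mono)
      show "(\<lambda>r. ?h r x) summable_on UNIV"
        using summable_on_SigmaD1[OF sm'] by simp
      fix r
      have "(pmf (joint_pmf D M q) (r, x) - response_prob D M q r * element_prob D x) * pmf (f r) u
          \<le> ?h r x"
        by (intro mult_right_mono) (auto simp: excess_def)
      then show "pmf (joint_pmf D M q) (r, x) * pmf (f r) u
            - response_prob D M q r * pmf (f r) u * element_prob D x \<le> ?h r x"
        by (simp add: algebra_simps)
    qed (intro summable_on_diff sJ sR)
    \<comment> \<open>The bounding sum is nonnegative, so the bound passes to the positive part of
      the difference.\<close>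
    finally show ?thesis
      by (simp add: excess_def[of D "post_process f M"] infsum_nonneg excess_nonneg)
  qed
  have "scaled_loss D (post_process f M) q u \<le> (\<Sum>\<^sub>\<infinity>x. \<Sum>\<^sub>\<infinity>r. ?h r x)"
    unfolding scaled_loss_def
  proof (rule infsum_mono)
    show "excess D (post_process f M) q u summable_on UNIV"
      using summable_on_SigmaD1[OF excess_summable_on[of D "post_process f M" q UNIV UNIV]] by simp
    show "(\<lambda>x. \<Sum>\<^sub>\<infinity>r. ?h r x) summable_on UNIV"
      using summable_on_Sigma_banach[OF sm'] by simp
  qed (rule le)
  also have "\<dots> = (\<Sum>\<^sub>\<infinity>r. \<Sum>\<^sub>\<infinity>x. ?h r x)"
    by (rule infsum_swap_banach[OF sm'])
  also have "\<dots> = (\<Sum>\<^sub>\<infinity>r. scaled_loss D M q r * pmf (f r) u)"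
    by (simp add: scaled_loss_def infsum_cmult_left')
  finally show ?thesis .
qed

lemma LSS_post_process:
  fixes M :: "('x, 'n::finite, 'q, 'r) mechanism"
  assumes "LSS \<epsilon> \<delta> D q M"
  shows "LSS \<epsilon> \<delta> D q (post_process f M)"
  unfolding LSS_iff
proof
  fix us
  define d where "d r = scaled_loss D M q r - \<epsilon> * response_prob D M q r" for r
  define g where "g r = max 0 (d r)" for r
  have d_sm: "d summable_on A" for A
    unfolding d_def[abs_def]
    by (intro summable_on_diff summable_on_cmult_right scaled_loss_summable_on response_prob_summable_on)
  \<comment> \<open>The total of \<open>g\<close> is the sum of \<open>d\<close> over the worst set
    of responses, which is where the hypothesis on \<open>M\<close> gets applied.\<close>
  have g_eq: "infsum g UNIV = infsum d {r. 0 < d r}"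
    by (rule infsum_cong_neutral) (auto simp: g_def)
  have "g summable_on UNIV \<longleftrightarrow> d summable_on {r. 0 < d r}"
    by (rule summable_on_cong_neutral) (auto simp: g_def)
  then have g_sm: "g summable_on UNIV"
    by (simp add: d_sm)
  have sm: "(\<lambda>(r, u). g r * pmf (f r) u) summable_on UNIV \<times> us"
    by (rule kernel_summable_on[OF g_sm]) (simp add: g_def)
  then have sm': "(\<lambda>(u, r). g r * pmf (f r) u) summable_on us \<times> UNIV"
    by (subst summable_on_swap) simp
  have pointwise: "scaled_loss D (post_process f M) q u - \<epsilon> * response_prob D (post_process f M) q u
      \<le> (\<Sum>\<^sub>\<infinity>r. g r * pmf (f r) u)" if "u \<in> us" for u
  proof -
    have sL: "(\<lambda>r. scaled_loss D M q r * pmf (f r) u) summable_on UNIV"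
      by (rule summable_on_comparison_test[OF scaled_loss_summable_on[of D M q]])
        (auto simp: scaled_loss_nonneg pmf_le_1 mult_left_le)
    have sR: "(\<lambda>r. \<epsilon> * (response_prob D M q r * pmf (f r) u)) summable_on UNIV"
      by (intro summable_on_cmult_right) (simp add: response_prob_eq_pmf pmf_mult_summable_on pmf_le_1)
    have "scaled_loss D (post_process f M) q u - \<epsilon> * response_prob D (post_process f M) q u
        \<le> (\<Sum>\<^sub>\<infinity>r. scaled_loss D M q r * pmf (f r) u)
            - (\<Sum>\<^sub>\<infinity>r. \<epsilon> * (response_prob D M q r * pmf (f r) u))"
      by (simp add: response_prob_post_process scaled_loss_post_process_le infsum_cmult_right')
    also have "\<dots> = (\<Sum>\<^sub>\<infinity>r. scaled_loss D M q r * pmf (f r) u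
            - \<epsilon> * (response_prob D M q r * pmf (f r) u))"
      by (rule infsum_diff[OF sL sR, symmetric])
    also have "\<dots> \<le> (\<Sum>\<^sub>\<infinity>r. g r * pmf (f r) u)"
    proof (rule infsum_mono)
      show "(\<lambda>r. g r * pmf (f r) u) summable_on UNIV"
        using summable_on_SigmaD1[OF sm' that] by simp
      fix r
      \<comment> \<open>Passing from \<open>d\<close> to \<open>g\<close> must precede the sum over
        \<open>us\<close>: the weights of \<open>us\<close> may total less than one, and dropping
        the missing mass is an upper bound only for nonnegative terms.\<close>
      have "d r * pmf (f r) u \<le> g r * pmf (f r) u"
        by (intro mult_right_mono) (auto simp: g_def)
      then show "scaled_loss D M q r * pmf (f r) u - \<epsilon> * (response_prob D M q r * pmf (f r) u)
          \<le> g r * pmf (f r) u"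
        by (simp add: d_def algebra_simps)
    qed (intro summable_on_diff sL sR)
    finally show ?thesis .
  qed
  have "(\<Sum>\<^sub>\<infinity>u\<in>us. scaled_loss D (post_process f M) q u
            - \<epsilon> * response_prob D (post_process f M) q u)
      \<le> (\<Sum>\<^sub>\<infinity>u\<in>us. \<Sum>\<^sub>\<infinity>r. g r * pmf (f r) u)"
  proof (rule infsum_mono)
    show "(\<lambda>u. \<Sum>\<^sub>\<infinity>r. g r * pmf (f r) u) summable_on us"
      using summable_on_Sigma_banach[OF sm'] by simp
  qed (auto intro!: pointwise summable_on_diff summable_on_cmult_right scaled_loss_summable_on
      response_prob_summable_on)
  also have "\<dots> = (\<Sum>\<^sub>\<infinity>r. \<Sum>\<^sub>\<infinity>u\<in>us. g r * pmf (f r) u)"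
    by (rule infsum_swap_banach[OF sm'])
  also have "\<dots> \<le> (\<Sum>\<^sub>\<infinity>r. g r)"
  proof (rule infsum_mono[OF _ g_sm])
    show "(\<lambda>r. \<Sum>\<^sub>\<infinity>u\<in>us. g r * pmf (f r) u) summable_on UNIV"
      using summable_on_Sigma_banach[OF sm] by simp
    show "(\<Sum>\<^sub>\<infinity>u\<in>us. g r * pmf (f r) u) \<le> g r" for r
      by (simp add: infsum_cmult_right' mult_left_le infsum_pmf_le_1 g_def)
  qed
  \<comment> \<open>The LSS bound is instantiated at the set \<open>{r. 0 < d r}\<close>.\<close>
  also have "\<dots> \<le> \<delta>"
    using assms by (simp add: LSS_iff g_eq d_def[abs_def])
  finally show "(\<Sum>\<^sub>\<infinity>u\<in>us. scaled_loss D (post_process f M) q u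
      - \<epsilon> * response_prob D (post_process f M) q u) \<le> \<delta>" .
qed

theorem theorem2p4:
  fixes \<epsilon> \<delta> :: real
    and M :: "('x::countable, 'n::finite, 'q::countable, 'r::countable) mechanism"
    and f :: "'r \<Rightarrow> 'u::countable pmf"
  assumes "0 \<le> \<epsilon>" "\<epsilon> \<le> 1" "0 \<le> \<delta>" "\<delta> \<le> 1"
  shows "(\<forall>(D :: ('x ^ 'n) pmf) (q :: 'q).
            LSS \<epsilon> \<delta> D q M \<longrightarrow> LSS \<epsilon> \<delta> D q (post_process f M)) \<and>
         (\<forall>(DD :: ('x ^ 'n) pmf set) (QQ :: 'q set).
            (\<forall>D\<in>DD. \<forall>q\<in>QQ. LSS \<epsilon> \<delta> D q M) \<longrightarrow>
            (\<forall>D\<in>DD. \<forall>q\<in>QQ. LSS \<epsilon> \<delta> D q (post_process f M)))"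
  by (simp add: LSS_post_process)

end
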